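(* The E-cuts generalize the P-cuts and the S-cuts: for every VRPSD instance with recourse costs $\mathcal{Q}_p$, every P-cut and every S-cut is an E-cut for a suitable choice of $S\subseteq N$, $E_S\subseteq E(S)$, and admissible values $m_{E_S}$ and $\mathcal{L}_{E_S}$.
   Context: Let $N=\{1,\dots,n\}$ be customers, $0$ the depot, $E$ the edge set of the complete undirected graph on $\{0\}\cup N$, and for $S\subseteq N$ let $E(S)$ be the set of edges with both endpoints in $S$. Customers have independent non-negative random demands with finite means $\mu_i$; $Q>0$ is the vehicle capacity and $f>0$ the load factor, with $\max_i\mu_i\le fQ$. A path is a nonempty sequence $p=(i_1,\dots,i_t)$ of distinct customers, $N(p)$ its customer set, and $\mathcal{P}=\{p:\sum_{i\in N(p)}\mu_i\le fQ\}$. A route-based recourse policy assigns to each path a finite cost $\bar{\mathcal{Q}}_p\ge0$, and $\mathcal{Q}_p$ is the minimum of $\bar{\mathcal{Q}}$ over $p$ and its reversal. Inequalities below are in variables $x\in\mathbb{R}^E$, $\theta\in\mathbb{R}^N$. For nonempty $S\subseteq N$, $\Pi(S,m)$ is the set of all sets of $m$ feasible paths whose customer sets partition $S$, $m(S)=\min\{m:\Pi(S,m)\ne\emptyset\}$, $\mathcal{L}(S,m)=\min_{\pi\in\Pi(S,m)}\sum_{p\in\pi}\mathcal{Q}_p$. For $E_S\subseteq E(S)$, $\bar{\mathcal{P}}(E_S)\subseteq\mathcal{P}$ is the set of feasible paths in the graph $(S,E_S)$ (single-customer paths included), $\bar\Pi(E_S,m)=\{\pi\in\Pi(S,m):\pi\subseteq\bar{\mathcal{P}}(E_S)\}$,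 $\bar m(E_S)=\min\{m:\bar\Pi(E_S,m)\ne\emptyset\}$, $\bar{\mathcal{L}}(E_S,m)=\min_{\pi\in\bar\Pi(E_S,m)}\sum_{p\in\pi}\mathcal{Q}_p$. Minima over empty sets are $+\infty$. - P-cut of $p=(i_1,\dots,i_t)\in\mathcal{P}$: $\sum_{i\in N(p)}\theta_i\ge\mathcal{Q}_p\left(\sum_{j=1}^{t-1}x_{\{i_j,i_{j+1}\}}-|N(p)|+2\right)$. - S-cut of $S$, with integer $1\le m_S\le m(S)$ and real $0\le\mathcal{L}_S\le\mathcal{L}(S,m_S)$: $\sum_{i\in S}\theta_i\ge\mathcal{L}_S\left(\sum_{e\in E(S)}x_e-|S|+m_S+1\right)$. - E-cut of $E_S\subseteq E(S)$, with admissible values being an integer $1\le m_{E_S}\le\bar m(E_S)$ and a real $0\le\mathcal{L}_{E_S}\le\bar{\mathcal{L}}(E_S,m_{E_S})$: $\sum_{i\in S}\theta_i\ge\mathcal{L}_{E_S}\left(\sum_{e\in E_S}x_e-|S|+m_{E_S}+1\right)$. *)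

theory Defs
  imports "HOL-Probability.Independent_Family"
begin

(* Customers are 1, ..., n (field num_customers), the depot is 0. The fields capacity, load_factor
   and policy_cost are the Q, f and Q-bar of the literature. Paths are lists of customers. *)

record 'w vrpsd =
  num_customers :: nat
  prob_measure :: "'w measure"
  demand :: "nat \<Rightarrow> 'w \<Rightarrow> real"
  capacity :: real
  load_factor :: real
  policy_cost :: "nat list \<Rightarrow> real"

definition customers :: "'w vrpsd \<Rightarrow> nat set" where
  "customers I = {1..num_customers I}"

definition mean_demand :: "'w vrpsd \<Rightarrow> nat \<Rightarrow> real" where
  "mean_demand I i = prob_space.expectation (prob_measure I) (demand I i)"

definition paths :: "'w vrpsd \<Rightarrow> nat list set" where
  "paths I = {p. p \<noteq> [] \<and> distinct p \<and> set p \<subseteq> customers I}"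

(* prob_space.indep_vars includes measurability of each demand. *)
definition vrpsd_instance :: "'w vrpsd \<Rightarrow> bool" where
  "vrpsd_instance I \<longleftrightarrow>
     prob_space (prob_measure I) \<and>
     prob_space.indep_vars (prob_measure I) (\<lambda>_. borel) (demand I) (customers I) \<and>
     (\<forall>i\<in>customers I. AE w in prob_measure I. 0 \<le> demand I i w) \<and>
     (\<forall>i\<in>customers I. integrable (prob_measure I) (demand I i)) \<and>
     0 < capacity I \<and> 0 < load_factor I \<and>
     (\<forall>i\<in>customers I. mean_demand I i \<le> load_factor I * capacity I) \<and>
     (\<forall>p\<in>paths I. 0 \<le> policy_cost I p)"

definition feasible_paths :: "'w vrpsd \<Rightarrow> nat list set" where
  "feasible_paths I =
     {p \<in> paths I. (\<Sum>i\<in>set p. mean_demand I i) \<le> load_factor I * capacity I}"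

definition recourse_cost :: "'w vrpsd \<Rightarrow> nat list \<Rightarrow> real" where
  "recourse_cost I p = min (policy_cost I p) (policy_cost I (rev p))"

definition edges :: "'w vrpsd \<Rightarrow> nat set set" where
  "edges I = {{u, v} | u v. u \<in> {0} \<union> customers I \<and> v \<in> {0} \<union> customers I \<and> u \<noteq> v}"

definition induced_edges :: "'w vrpsd \<Rightarrow> nat set \<Rightarrow> nat set set" where
  "induced_edges I S = {e \<in> edges I. e \<subseteq> S}"

(* Disjointness is required of any two distinct paths, not merely of distinct customer sets, so a
   path and its reversal never occur together. *)
definition path_partitions :: "'w vrpsd \<Rightarrow> nat set \<Rightarrow> nat \<Rightarrow> nat list set set" where
  "path_partitions I S m =
     {\<pi>. \<pi> \<subseteq> feasible_paths I \<and> finite \<pi> \<and> card \<pi> = m \<and>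
         disjoint_family_on set \<pi> \<and> (\<Union>p\<in>\<pi>. set p) = S}"

(* All minima below are taken over subsets of enat or over finite families of reals (there are only
   finitely many paths), so Inf is the minimum when the index set is nonempty; otherwise it is
   infinity. *)

definition min_paths :: "'w vrpsd \<Rightarrow> nat set \<Rightarrow> enat" where
  "min_paths I S = Inf {enat m | m. path_partitions I S m \<noteq> {}}"

definition min_cost :: "'w vrpsd \<Rightarrow> nat set \<Rightarrow> nat \<Rightarrow> ereal" where
  "min_cost I S m =
     (INF \<pi>\<in>path_partitions I S m. ereal (\<Sum>p\<in>\<pi>. recourse_cost I p))"

(* The barred notions depend on S as well as on the edge set F, since (S, F) may have isolated
   vertices. *)

definition feasible_paths_in :: "'w vrpsd \<Rightarrow> nat set \<Rightarrow> nat set set \<Rightarrow> nat list set" where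
  "feasible_paths_in I S F =
     {p \<in> feasible_paths I. set p \<subseteq> S \<and> (\<forall>j < length p - 1. {p ! j, p ! Suc j} \<in> F)}"

definition path_partitions_in ::
    "'w vrpsd \<Rightarrow> nat set \<Rightarrow> nat set set \<Rightarrow> nat \<Rightarrow> nat list set set" where
  "path_partitions_in I S F m = {\<pi> \<in> path_partitions I S m. \<pi> \<subseteq> feasible_paths_in I S F}"

definition min_paths_in :: "'w vrpsd \<Rightarrow> nat set \<Rightarrow> nat set set \<Rightarrow> enat" where
  "min_paths_in I S F = Inf {enat m | m. path_partitions_in I S F m \<noteq> {}}"

definition min_cost_in :: "'w vrpsd \<Rightarrow> nat set \<Rightarrow> nat set set \<Rightarrow> nat \<Rightarrow> ereal" where
  "min_cost_in I S F m =
     (INF \<pi>\<in>path_partitions_in I S F m. ereal (\<Sum>p\<in>\<pi>. recourse_cost I p))"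

(* Geq l r is the inequality l x t \<ge> r x t in the variables x (indexed by edges) and t (indexed by
   customers). Points are total functions, but the cuts below only read x on edges and t on
   customers. Equality in this type means that both sides agree identically in x and t, which is
   stronger than having the same solutions. *)
datatype inequality =
  Geq "(nat set \<Rightarrow> real) \<Rightarrow> (nat \<Rightarrow> real) \<Rightarrow> real" "(nat set \<Rightarrow> real) \<Rightarrow> (nat \<Rightarrow> real) \<Rightarrow> real"

definition P_cut :: "'w vrpsd \<Rightarrow> nat list \<Rightarrow> inequality" where
  "P_cut I p =
     Geq (\<lambda>x \<theta>. \<Sum>i\<in>set p. \<theta> i)
         (\<lambda>x \<theta>. recourse_cost I p *
            ((\<Sum>j<length p - 1. x {p ! j, p ! Suc j}) - real (card (set p)) + 2))"

definition S_cut_admissible :: "'w vrpsd \<Rightarrow> nat set \<Rightarrow> nat \<Rightarrow> real \<Rightarrow> bool" where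
  "S_cut_admissible I S m L \<longleftrightarrow>
     S \<noteq> {} \<and> S \<subseteq> customers I \<and> 1 \<le> m \<and> enat m \<le> min_paths I S \<and>
     0 \<le> L \<and> ereal L \<le> min_cost I S m"

definition S_cut :: "'w vrpsd \<Rightarrow> nat set \<Rightarrow> nat \<Rightarrow> real \<Rightarrow> inequality" where
  "S_cut I S m L =
     Geq (\<lambda>x \<theta>. \<Sum>i\<in>S. \<theta> i)
         (\<lambda>x \<theta>. L * ((\<Sum>e\<in>induced_edges I S. x e) - real (card S) + real m + 1))"

definition E_cut_admissible ::
    "'w vrpsd \<Rightarrow> nat set \<Rightarrow> nat set set \<Rightarrow> nat \<Rightarrow> real \<Rightarrow> bool" where
  "E_cut_admissible I S F m L \<longleftrightarrow>
     S \<noteq> {} \<and> S \<subseteq> customers I \<and> F \<subseteq> induced_edges I S \<and>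
     1 \<le> m \<and> enat m \<le> min_paths_in I S F \<and>
     0 \<le> L \<and> ereal L \<le> min_cost_in I S F m"

definition E_cut :: "nat set \<Rightarrow> nat set set \<Rightarrow> nat \<Rightarrow> real \<Rightarrow> inequality" where
  "E_cut S F m L =
     Geq (\<lambda>x \<theta>. \<Sum>i\<in>S. \<theta> i)
         (\<lambda>x \<theta>. L * ((\<Sum>e\<in>F. x e) - real (card S) + real m + 1))"

end

theory Submission
  imports Defs
begin

text \<open>
  An S-cut is the E-cut with all edges inside S. For a P-cut, take the vertex set and the edge set
  of the path p and a single vehicle: the only Hamiltonian paths of a path graph are the path itself
  and its reversal, and they have the same recourse cost.
\<close>

text \<open>Injectivity forbids turning back: a step opposite to the preceding one would return to
  the value two positions earlier. Hence every step repeats the first one, \<open>d\<close>.\<close>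

lemma injective_unit_steps_monotone:
  fixes g :: "nat \<Rightarrow> int"
  assumes step: "\<And>j. Suc j < t \<Longrightarrow> \<bar>g (Suc j) - g j\<bar> = 1"
    and inj: "inj_on g {..<t}"
  obtains d where "d = 1 \<or> d = -1" "\<And>j. j < t \<Longrightarrow> g j = g 0 + d * int j"
proof (cases "1 < t")
  case True
  define d where "d = g 1 - g 0"
  have "\<bar>d\<bar> = 1"
    using step[of 0] True by (simp add: d_def)
  then have d: "d = 1 \<or> d = -1"
    by linarith
  have diff: "g (Suc j) - g j = d" if "Suc j < t" for j
    using that
  proof (induction j)
    case 0
    then show ?case by (simp add: d_def)
  next
    case (Suc j)
    \<comment> \<open>This rules out the step \<open>- d\<close>, which leaves only \<open>d\<close>
      among the two unit steps.\<close>
    have "g (Suc (Suc j)) \<noteq> g j"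
      using inj_onD[OF inj, of "Suc (Suc j)" j] Suc.prems by auto
    with Suc step[of "Suc j"] d show ?case
      by simp linarith
  qed
  have "g j = g 0 + d * int j" if "j < t" for j
    using that
  proof (induction j)
    case (Suc j)
    with diff[of j] show ?case
      by (simp add: algebra_simps)
  qed simp
  with d that show ?thesis by blast
next
  case False
  \<comment> \<open>At most the index 0 occurs here, so the direction is arbitrary.\<close>
  then have "g j = g 0 + 1 * int j" if "j < t" for j
    using that by (cases j) auto
  with that show ?thesis by blast
qed

text \<open>A progression of \<open>t\<close> terms with difference 1 or -1 fits below
  \<open>t\<close> only if it fills the whole range, so its starting point is forced to be an end of
  the range.\<close>

lemma bounded_injective_unit_steps:
  fixes g :: "nat \<Rightarrow> nat"
  assumes step: "\<And>j. Suc j < t \<Longrightarrow> g (Suc j) = Suc (g j) \<or> g j = Suc (g (Suc j))"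
    and inj: "inj_on g {..<t}"
    and bound: "\<And>j. j < t \<Longrightarrow> g j < t"
  shows "(\<forall>j<t. g j = j) \<or> (\<forall>j<t. g j = t - Suc j)"
proof (cases "t = 0")
  case False
  have "\<bar>int (g (Suc j)) - int (g j)\<bar> = 1" if "Suc j < t" for j
    using step[OF that] by auto
  moreover have "inj_on (\<lambda>j. int (g j)) {..<t}"
    using inj by (auto simp: inj_on_def)
  ultimately obtain d where d: "d = 1 \<or> d = -1"
    and g: "\<And>j. j < t \<Longrightarrow> int (g j) = int (g 0) + d * int j"
    using injective_unit_steps_monotone[of t "\<lambda>j. int (g j)"] by blast
  have last: "int (g (t - 1)) = int (g 0) + d * (int t - 1)"
    using g[of "t - 1"] False by (simp add: of_nat_diff)
  have ends: "g (t - 1) < t" "g 0 < t"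
    using bound False by auto
  show ?thesis
    using d
  proof
    assume "d = 1"
    with last ends have "g 0 = 0" by simp
    with g \<open>d = 1\<close> show ?thesis by simp
  next
    assume "d = -1"
    \<comment> \<open>The last value \<open>g 0 - (t - 1)\<close> is nonnegative because
      \<open>g\<close> takes natural values, and \<open>g 0 < t\<close>.\<close>
    with last ends have "int (g 0) = int t - 1" by simp
    then have "g j = t - Suc j" if "j < t" for j
      using g[OF that] that \<open>d = -1\<close> by simp
    then show ?thesis by blast
  qed
qed simp

text \<open>Written as an image of positions so that sums over this set can be reindexed to the sum
  over \<open>j\<close> in \<open>P_cut\<close>. A single vertex gives the empty set.\<close>

definition path_edges :: "'a list \<Rightarrow> 'a set set" where
  "path_edges p = (\<lambda>j. {p ! j, p ! Suc j}) ` {..<length p - 1}"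

text \<open>If two positions gave the same edge with its ends swapped, then \<open>i = Suc j\<close>
  and \<open>Suc i = j\<close>, which is absurd.\<close>

lemma inj_on_path_edge:
  assumes "distinct p"
  shows "inj_on (\<lambda>j. {p ! j, p ! Suc j}) {..<length p - 1}"
proof (rule inj_onI)
  fix i j
  assume ij: "i \<in> {..<length p - 1}" "j \<in> {..<length p - 1}"
    and eq: "{p ! i, p ! Suc i} = {p ! j, p ! Suc j}"
  then have "i < length p" "Suc i < length p" "j < length p" "Suc j < length p"
    by auto
  with eq assms show "i = j"
    by (auto simp: doubleton_eq_iff nth_eq_iff_index_eq)
qed

text \<open>Reading the vertices of \<open>q\<close> as positions in \<open>p\<close> gives an
  injective walk with unit steps on \<open>{..<length p}\<close>, which can only run straight up or
  straight down.\<close>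

lemma Hamiltonian_path_of_path_graph:
  assumes p: "distinct p" and q: "distinct q" and set_eq: "set q = set p"
    and edge: "\<And>j. j < length q - 1 \<Longrightarrow> {q ! j, q ! Suc j} \<in> path_edges p"
  shows "q = p \<or> q = rev p"
proof -
  have len: "length q = length p"
    using p q set_eq by (metis distinct_card)
  have "\<exists>k. j < length p \<longrightarrow> k < length p \<and> p ! k = q ! j" for j
    using nth_mem[of j q] len set_eq by (auto simp: in_set_conv_nth)
  \<comment> \<open>\<open>g j\<close> is the position in \<open>p\<close> of the
    \<open>j\<close>-th vertex of \<open>q\<close>.\<close>
  then obtain g where g: "\<And>j. j < length p \<Longrightarrow> g j < length p \<and> p ! g j = q ! j"
    by metis
  have inj: "inj_on g {..<length p}"
  proof (rule inj_onI)
    fix i j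
    assume ij: "i \<in> {..<length p}" "j \<in> {..<length p}" and "g i = g j"
    then have "q ! i = q ! j"
      using g[of i] g[of j] by auto
    with ij show "i = j"
      using q len by (simp add: nth_eq_iff_index_eq)
  qed
  have step: "g (Suc j) = Suc (g j) \<or> g j = Suc (g (Suc j))" if j: "Suc j < length p" for j
  proof -
    have "{q ! j, q ! Suc j} \<in> path_edges p"
      using edge j len by simp
    then obtain k where "k < length p - 1" and k: "{q ! j, q ! Suc j} = {p ! k, p ! Suc k}"
      unfolding path_edges_def by blast
    then have k': "k < length p" "Suc k < length p"
      by auto
    have gj: "g j < length p" "p ! g j = q ! j" "g (Suc j) < length p" "p ! g (Suc j) = q ! Suc j"
      using g[of j] g[of "Suc j"] j by auto
    then have "{p ! g j, p ! g (Suc j)} = {p ! k, p ! Suc k}"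
      using k by simp
    \<comment> \<open>\<open>q\<close> may traverse the edge in either direction. Distinctness of
      \<open>p\<close> turns the equal vertices into equal positions, giving a step up or
      down.\<close>
    then consider "p ! g j = p ! k" "p ! g (Suc j) = p ! Suc k"
      | "p ! g j = p ! Suc k" "p ! g (Suc j) = p ! k"
      by (auto simp: doubleton_eq_iff)
    then show ?thesis
      using gj(1,3) k' p by cases (simp_all add: nth_eq_iff_index_eq)
  qed
  have "(\<forall>j<length p. g j = j) \<or> (\<forall>j<length p. g j = length p - Suc j)"
    using bounded_injective_unit_steps[OF step inj] g by blast
  then show ?thesis
  proof
    assume "\<forall>j<length p. g j = j"
    then have "q = p"
      using g len by (metis nth_equalityI)
    then show ?thesis ..
  next
    assume "\<forall>j<length p. g j = length p - Suc j"
    then have "q = rev p"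
      using g len by (metis nth_equalityI length_rev rev_nth)
    then show ?thesis ..
  qed
qed

lemma recourse_cost_rev: "recourse_cost I (rev p) = recourse_cost I p"
  by (simp add: recourse_cost_def min.commute)

lemma path_edge_in_induced_edges:
  assumes "p \<in> paths I" "set p \<subseteq> S" "j < length p - 1"
  shows "{p ! j, p ! Suc j} \<in> induced_edges I S"
proof -
  have j: "j < length p" "Suc j < length p"
    using assms(3) by auto
  then have "p ! j \<in> set p" "p ! Suc j \<in> set p" "p ! j \<noteq> p ! Suc j"
    using assms(1) by (auto simp: paths_def nth_eq_iff_index_eq)
  moreover have "{p ! j, p ! Suc j} \<subseteq> customers I"
    using calculation assms(1) by (auto simp: paths_def)
  ultimately show ?thesis
    using assms(2) unfolding induced_edges_def edges_def by blast
qed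

text \<open>The underlying graph is complete, so a path inside \<open>S\<close> uses only edges of
  \<open>induced_edges I S\<close> and the restriction excludes nothing.\<close>

lemma path_partitions_in_induced_edges:
  "path_partitions_in I S (induced_edges I S) m = path_partitions I S m"
proof -
  have "\<pi> \<subseteq> feasible_paths_in I S (induced_edges I S)" if "\<pi> \<in> path_partitions I S m" for \<pi>
  proof
    fix p
    assume "p \<in> \<pi>"
    with that have "p \<in> feasible_paths I" "set p \<subseteq> S"
      by (auto simp: path_partitions_def)
    then show "p \<in> feasible_paths_in I S (induced_edges I S)"
      using path_edge_in_induced_edges[of p I S]
      by (auto simp: feasible_paths_in_def feasible_paths_def)
  qed
  then show ?thesis
    by (auto simp: path_partitions_in_def)
qed

text \<open>No paths cover only the empty set. This makes the value 1 admissible for the E-cut of a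
  path.\<close>

lemma min_paths_in_pos:
  assumes "S \<noteq> {}"
  shows "1 \<le> min_paths_in I S F"
proof -
  have "path_partitions_in I S F 0 = {}"
    using assms by (auto simp: path_partitions_in_def path_partitions_def)
  then have "1 \<le> m" if "path_partitions_in I S F m \<noteq> {}" for m
    using that by (cases m) auto
  then show ?thesis
    unfolding min_paths_in_def by (intro Inf_greatest) (force simp: one_enat_def)
qed

lemma min_cost_in_path_edges_ge:
  assumes "p \<in> feasible_paths I"
  shows "ereal (recourse_cost I p) \<le> min_cost_in I (set p) (path_edges p) 1"
  unfolding min_cost_in_def
proof (rule INF_greatest)
  fix \<pi>
  assume \<pi>: "\<pi> \<in> path_partitions_in I (set p) (path_edges p) 1"
  \<comment> \<open>With one vehicle the partition is a single path, which must visit all of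
    \<open>set p\<close>.\<close>
  then obtain q where q: "\<pi> = {q}"
    by (auto simp: path_partitions_in_def path_partitions_def card_Suc_eq)
  with \<pi> assms have "q = p \<or> q = rev p"
    by (intro Hamiltonian_path_of_path_graph)
      (auto simp: path_partitions_in_def path_partitions_def feasible_paths_in_def
        feasible_paths_def paths_def)
  with q show "ereal (recourse_cost I p) \<le> ereal (\<Sum>p\<in>\<pi>. recourse_cost I p)"
    by (auto simp: recourse_cost_rev)
qed

lemma P_cut_is_E_cut:
  assumes "vrpsd_instance I" and p: "p \<in> feasible_paths I"
  shows "E_cut_admissible I (set p) (path_edges p) 1 (recourse_cost I p)"
    and "P_cut I p = E_cut (set p) (path_edges p) 1 (recourse_cost I p)"
proof -
  have path: "p \<in> paths I"
    using p by (simp add: feasible_paths_def)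
  \<comment> \<open>The recourse cost is a minimum over both orientations, so its nonnegativity
    needs the policy cost of the reversal as well.\<close>
  then have "rev p \<in> paths I"
    by (simp add: paths_def)
  with path assms(1) have "0 \<le> recourse_cost I p"
    by (simp add: vrpsd_instance_def recourse_cost_def)
  moreover have "path_edges p \<subseteq> induced_edges I (set p)"
    using path_edge_in_induced_edges[OF path subset_refl] by (auto simp: path_edges_def)
  ultimately show "E_cut_admissible I (set p) (path_edges p) 1 (recourse_cost I p)"
    using path min_paths_in_pos[of "set p" I] min_cost_in_path_edges_ge[OF p]
    by (auto simp: E_cut_admissible_def paths_def one_enat_def)
  have "(\<Sum>e\<in>path_edges p. x e) = (\<Sum>j<length p - 1. x {p ! j, p ! Suc j})" for x :: "nat set \<Rightarrow> real"
    unfolding path_edges_def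
    using path by (subst sum.reindex[OF inj_on_path_edge]) (auto simp: paths_def)
  \<comment> \<open>The constant 2 of the P-cut is \<open>m + 1\<close> for
    \<open>m = 1\<close>.\<close>
  then show "P_cut I p = E_cut (set p) (path_edges p) 1 (recourse_cost I p)"
    by (simp add: P_cut_def E_cut_def add.assoc)
qed

lemma S_cut_is_E_cut:
  assumes "S_cut_admissible I S m L"
  shows "E_cut_admissible I S (induced_edges I S) m L"
    and "S_cut I S m L = E_cut S (induced_edges I S) m L"
  using assms
  by (simp_all add: S_cut_admissible_def E_cut_admissible_def S_cut_def E_cut_def
      min_paths_def min_paths_in_def min_cost_def min_cost_in_def path_partitions_in_induced_edges)

theorem proposition4:
  fixes I :: "'w vrpsd"
  assumes "vrpsd_instance I"
  shows "(\<forall>p\<in>feasible_paths I.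
            \<exists>S F m L. E_cut_admissible I S F m L \<and> P_cut I p = E_cut S F m L) \<and>
         (\<forall>S m L. S_cut_admissible I S m L \<longrightarrow>
            (\<exists>S' F m' L'. E_cut_admissible I S' F m' L' \<and> S_cut I S m L = E_cut S' F m' L'))"
  using P_cut_is_E_cut[OF assms] S_cut_is_E_cut by meson

end
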